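(* Let $0<q<1$, let $l>0$, let $0\le a_{1},\dots,a_{r},b_{1},\dots,b_{s}<1$, and let $u\in\mathbb{C}\setminus\{0\}$. Let $$f(z)=\sum_{k=0}^{\infty}\frac{(a_{1},\dots,a_{r};q)_{k}\,q^{lk^{2}}}{(b_{1},\dots,b_{s};q)_{k}}z^{k},\qquad c(r,s;q)=\frac{(b_{1},\dots,b_{s};q)_{\infty}}{(a_{1},\dots,a_{r};q)_{\infty}}.$$ (1) Let $t$ be a positive rational number and let $\lambda\in\mathbb{S}(t)$. There are infinitely many pairs of positive integers $n$ and $m$ such that $$tn=m+\lambda .$$ For each such $\lambda$, $n$ and $m$ we have $$f(q^{-lnt}u)=\frac{u^{\lfloor m/2\rfloor}\left\{\theta(u^{-1}q^{l\chi(m)+l\lambda};q^{2l})+r(n)\right\}}{c(r,s;q)\,q^{l\lfloor m/2\rfloor(nt-\lfloor m/2\rfloor)}},$$ where, for all such $n$ sufficiently large (with all other parameters fixed), $$|r(n)|\le\left(\frac{2}{1-q}\right)^{r+s+1}\frac{\prod_{j=1}^{s}(-b_{j}q^{2};q)_{\infty}\,\theta(|u|^{-1};q^{l})}{\prod_{j=1}^{r}(a_{j};q)_{\infty}}\left\{q^{m/4}+\frac{q^{lm^{2}/16}}{|u|^{\lfloor m/4\rfloor+1}}\right\}.$$ (2) Let $t$ be a positive irrational number and let $\beta\in[0,1)$. There are infinitely many pairs of positive integers $n$ and $m$ such that $$nt=m+\beta+\gamma_{n}\quad\text{with}\quad|\gamma_{n}|\le\frac{3}{n}.$$ Let $$\nu_{n}=\left\lfloor-\frac{q^{2}\log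 n}{\log q}\right\rfloor .$$ For each such $\beta$, $n$ and $m$ we have $$f(q^{-lnt}u)=\frac{u^{\lfloor m/2\rfloor}\left\{\theta(u^{-1}q^{l\chi(m)+l\beta};q^{2l})+e(n)\right\}}{c(r,s;q)\,q^{l\lfloor m/2\rfloor(nt-\lfloor m/2\rfloor)}},$$ where, for all such $n$ sufficiently large (with all other parameters fixed), $$|e(n)|\le\frac{48\prod_{j=1}^{s}(-b_{j}q^{2};q)_{\infty}\,\theta(|u|^{-1};q^{l})}{(1-q)\prod_{j=1}^{r}(a_{j};q)_{\infty}}\left\{\frac{\log n}{n}+q^{l\nu_{n}^{2}/2}|u|^{\nu_{n}}+\frac{q^{l\nu_{n}^{2}/2}}{|u|^{1+\nu_{n}}}\right\}.$$
   Context: Throughout $0<q<1$. For $a\in\mathbb{C}$, $(a;q)_{\infty}=\prod_{k=0}^{\infty}(1-aq^{k})$ and $(a;q)_{n}=(a;q)_{\infty}/(aq^{n};q)_{\infty}$ for integers $n$ (so $(a;q)_n=\prod_{k=0}^{n-1}(1-aq^k)$ for $n\ge 0$). For $k$ a nonnegative integer or $\infty$, $(a_{1},\dots,a_{r};q)_{k}=\prod_{j=1}^{r}(a_{j};q)_{k}$. For nonzero $z\in\mathbb{C}$ and any base $p\in(0,1)$, the theta function is $\theta(z;p)=\sum_{k=-\infty}^{\infty}p^{k^{2}/2}z^{k}$; in particular $\theta(z;q^{2l})=\sum_{k=-\infty}^{\infty}q^{lk^{2}}z^{k}$. For real $x$, $\lfloor x\rfloor$ is the greatest integer $\le x$ and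 $\{x\}=x-\lfloor x\rfloor\in[0,1)$ is the fractional part. For an integer $n$, $\chi(n)=n-2\lfloor n/2\rfloor$, i.e. $\chi(n)=1$ if $n$ is odd and $0$ if $n$ is even. For a positive real number $t$, $\mathbb{S}(t)=\{\{nt\}:n\in\mathbb{N}\}$, where $\mathbb{N}$ is the set of positive integers. The integers $r,s\ge0$ are the numbers of parameters $a_j$, $b_j$; the remainder $r(n)$ is unrelated to the integer $r$. The displayed identities for $f(q^{-lnt}u)$ define the remainders $r(n)$ and $e(n)$, whose bounds are then asserted. *)

theory Defs
  imports "HOL-Analysis.Analysis"
begin

text \<open>The definitions are polymorphic so that they serve both for complex arguments and for the
  real quantities occurring in the error bounds.\<close>

definition qpoch_inf :: "'a::real_normed_field \<Rightarrow> real \<Rightarrow> 'a" where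
  "qpoch_inf a q = (\<Prod>k. 1 - a * of_real (q ^ k))"

definition qpoch :: "'a::real_normed_field \<Rightarrow> real \<Rightarrow> int \<Rightarrow> 'a" where
  "qpoch a q n = qpoch_inf a q / qpoch_inf (a * of_real (q powi n)) q"

definition theta :: "'a::real_normed_field \<Rightarrow> real \<Rightarrow> 'a" where
  "theta z p = (\<Sum>\<^sub>\<infinity>k\<in>(UNIV::int set). of_real (p powr (real_of_int k ^ 2 / 2)) * z powi k)"

definition chi :: "int \<Rightarrow> int" where
  "chi n = n - 2 * \<lfloor>real_of_int n / 2\<rfloor>"

definition frac_multiples :: "real \<Rightarrow> real set" where
  "frac_multiples t = {frac (real n * t) | n::nat. n > 0}"

text \<open>The parameters are \<open>a 1, \<dots>, a r\<close> and \<open>b 1, \<dots>, b s\<close>; other values of \<open>a\<close> and \<open>b\<close> are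
  irrelevant.\<close>

definition qseries ::
    "real \<Rightarrow> real \<Rightarrow> nat \<Rightarrow> (nat \<Rightarrow> real) \<Rightarrow> nat \<Rightarrow> (nat \<Rightarrow> real) \<Rightarrow> complex \<Rightarrow> complex" where
  "qseries q l r a s b z =
     (\<Sum>k. of_real ((\<Prod>j=1..r. qpoch (a j) q (int k)) * q powr (l * real k ^ 2)
                  / (\<Prod>j=1..s. qpoch (b j) q (int k))) * z ^ k)"

definition cconst :: "real \<Rightarrow> nat \<Rightarrow> (nat \<Rightarrow> real) \<Rightarrow> nat \<Rightarrow> (nat \<Rightarrow> real) \<Rightarrow> real" where
  "cconst q r a s b = (\<Prod>j=1..s. qpoch_inf (b j) q) / (\<Prod>j=1..r. qpoch_inf (a j) q)"

definition nu :: "real \<Rightarrow> nat \<Rightarrow> int" where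
  "nu q n = \<lfloor>- (q ^ 2 * ln (real n) / ln q)\<rfloor>"

end

theory Submission
  imports Defs
begin

text \<open>Put \<open>M = \<lfloor>m / 2\<rfloor>\<close>, \<open>c = c(r,s;q)\<close> and \<open>y = nt - 2M\<close>. The coefficients of \<open>f\<close>, multiplied by \<open>c\<close>,
  are \<open>g k = \<Prod>(b\<^sub>j q^k;q)\<^sub>\<infinity> / \<Prod>(a\<^sub>j q^k;q)\<^sub>\<infinity>\<close>, and \<open>g k - 1 = O(q^k)\<close>. Substituting \<open>k = M - j\<close>
  turns \<open>f(q^(-lnt) u)\<close> into \<open>u^M / (c q^(lM(nt - M)))\<close> times \<open>\<Sum>j\<le>M. g (M - j) T\<^sub>y(j)\<close>, where
  \<open>T\<^sub>y(j) = q^(lj\<^sup>2) (u^(-1) q^(ly))^j\<close> are the terms of the theta series. Extending \<open>g\<close> by zero to negative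
  indices keeps \<open>g i - 1 = O(q^i)\<close>, so the missing tail \<open>j > M\<close> and the error of replacing \<open>g\<close> by 1
  are together \<open>O(q^M \<Sum>j. q^(-j) \<bar>T\<^sub>y(j)\<bar>) = O(q^M)\<close>; changing \<open>y\<close> by \<open>\<gamma>\<close> costs another \<open>O(\<bar>\<gamma>\<bar>)\<close>.
  These bounds beat the asserted ones for large \<open>n\<close>, because \<open>q^M = o(q^(m/4))\<close> and \<open>1/n = o(log n / n)\<close>.\<close>

section \<open>Weights\<close>

lemma mult_power_less_one:
  fixes x q :: real
  assumes "0 < q" "q < 1" "x < 1"
  shows "x * q ^ k < 1"
proof (cases "x \<le> 0")
  case True
  then have "x * q ^ k \<le> 0"
    using assms by (simp add: mult_nonpos_nonneg)
  then show ?thesis by linarith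
next
  case False
  then have "x * q ^ k \<le> x"
    using assms by (simp add: mult_left_le power_le_one)
  then show ?thesis using assms by linarith
qed

lemma qpoch_inf_convergent:
  fixes x q :: real
  assumes "0 < q" "q < 1" "x < 1"
  shows "convergent_prod (\<lambda>k. 1 - x * q ^ k)"
proof -
  have "x * q ^ k \<noteq> 1" for k
    using mult_power_less_one[OF assms, of k] by simp
  moreover have "summable (\<lambda>k. \<bar>- x * q ^ k\<bar>)"
    using assms by (auto simp: abs_mult intro!: summable_mult summable_geometric)
  ultimately show ?thesis
    using summable_imp_convergent_prod_real[of "\<lambda>k. - x * q ^ k"] by auto
qed

text \<open>The argument may be negative: besides the parameters themselves, the values
  \<open>- b j * q ^ 2\<close> from the error bounds have to be covered.\<close>

lemma qpoch_inf_pos: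
  fixes x q :: real
  assumes "0 < q" "q < 1" "x < 1"
  shows "0 < qpoch_inf x q"
  unfolding qpoch_inf_def of_real_def real_scaleR_def mult_1_right
proof (rule less_0_prodinf)
  show "convergent_prod (\<lambda>k. 1 - x * q ^ k)"
    using assms by (rule qpoch_inf_convergent)
  show "0 < 1 - x * q ^ k" for k
    using mult_power_less_one[OF assms, of k] by simp
qed

lemma qpoch_inf_le_1:
  fixes x q :: real
  assumes "0 < q" "q < 1" "0 \<le> x" "x < 1"
  shows "qpoch_inf x q \<le> 1"
  unfolding qpoch_inf_def of_real_def real_scaleR_def mult_1_right
proof (rule prodinf_le_const[where N=0])
  show "convergent_prod (\<lambda>k. 1 - x * q ^ k)"
    using assms by (intro qpoch_inf_convergent)
  fix n
  have "0 \<le> 1 - x * q ^ k \<and> 1 - x * q ^ k \<le> 1" for k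
    using assms mult_mono[of x 1 "q ^ k" 1] by (simp add: power_le_one)
  then show "(\<Prod>k<n. 1 - x * q ^ k) \<le> 1"
    by (intro prod_le_1) auto
qed

text \<open>Weierstrass' inequality bounds each finite product below by 1 minus the sum of the
  \<open>x * q ^ k\<close>, and the full geometric sum is x / (1 - q). At an argument x q^k the
  product is therefore 1 - O(q^k).\<close>

lemma qpoch_inf_ge:
  fixes x q :: real
  assumes "0 < q" "q < 1" "0 \<le> x" "x < 1"
  shows "1 - x / (1 - q) \<le> qpoch_inf x q"
  unfolding qpoch_inf_def of_real_def real_scaleR_def mult_1_right
proof (rule LIMSEQ_le_const)
  show "(\<lambda>n. \<Prod>k\<le>n. 1 - x * q ^ k) \<longlonglongrightarrow> (\<Prod>k. 1 - x * q ^ k)"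
    using assms by (intro convergent_prod_LIMSEQ qpoch_inf_convergent)
  have "1 - x / (1 - q) \<le> (\<Prod>k\<le>n. 1 - x * q ^ k)" for n
  proof -
    have "(\<Sum>k\<le>n. x * q ^ k) \<le> (\<Sum>k. x * q ^ k)"
      using assms by (intro sum_le_suminf summable_mult summable_geometric) auto
    also have "\<dots> = x / (1 - q)"
      using assms by (subst suminf_mult) (auto simp: suminf_geometric summable_geometric)
    finally have "1 - x / (1 - q) \<le> 1 - (\<Sum>k\<le>n. x * q ^ k)" by simp
    also have "\<dots> \<le> (\<Prod>k\<le>n. 1 - x * q ^ k)"
      using assms mult_mono[of x 1 "q ^ _" 1]
      by (intro Weierstrass_prod_ineq) (simp add: power_le_one)
    finally show ?thesis .
  qed
  then show "\<exists>N. \<forall>n\<ge>N. 1 - x / (1 - q) \<le> (\<Prod>k\<le>n. 1 - x * q ^ k)" by blast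
qed

text \<open>The factors compare one by one. At arguments \<open>x * q ^ k\<close> this yields a
  positive lower bound uniform in k, which is what inverting the products requires.\<close>

lemma qpoch_inf_antimono:
  fixes x y q :: real
  assumes "0 < q" "q < 1" "0 \<le> x" "x \<le> y" "y < 1"
  shows "qpoch_inf y q \<le> qpoch_inf x q"
  unfolding qpoch_inf_def of_real_def real_scaleR_def mult_1_right
proof (rule has_prod_le)
  show "(\<lambda>k. 1 - y * q ^ k) has_prod (\<Prod>k. 1 - y * q ^ k)"
    "(\<lambda>k. 1 - x * q ^ k) has_prod (\<Prod>k. 1 - x * q ^ k)"
    using assms by (auto intro!: convergent_prod_has_prod qpoch_inf_convergent)
  show "0 \<le> 1 - y * q ^ k \<and> 1 - y * q ^ k \<le> 1 - x * q ^ k" for k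
    using assms mult_mono[of y 1 "q ^ k" 1] by (simp add: power_le_one mult_right_mono)
qed

text \<open>The rate q^k is chosen because at k = M - j it splits as q^M q^(-j): the first factor is
  the gain, the second is absorbed by the Gaussian decay of the theta terms.\<close>

definition geom_close :: "real \<Rightarrow> (nat \<Rightarrow> real) \<Rightarrow> bool" where
  "geom_close q g \<longleftrightarrow> (\<exists>C\<ge>0. \<forall>k. \<bar>g k - 1\<bar> \<le> C * q ^ k)"

text \<open>g h - 1 = (g - 1) h + (h - 1), where h is bounded by 1 + D.\<close>

lemma geom_close_mult:
  assumes "0 < q" "q < 1" "geom_close q g" "geom_close q h"
  shows "geom_close q (\<lambda>k. g k * h k)"
proof -
  obtain C D where C: "C \<ge> 0" "\<And>k. \<bar>g k - 1\<bar> \<le> C * q ^ k"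
    and D: "D \<ge> 0" "\<And>k. \<bar>h k - 1\<bar> \<le> D * q ^ k"
    using assms(3,4) unfolding geom_close_def by metis
  have "\<bar>g k * h k - 1\<bar> \<le> (C * (1 + D) + D) * q ^ k" for k
  proof -
    have "D * q ^ k \<le> D"
      using assms D by (simp add: mult_left_le power_le_one)
    then have h: "\<bar>h k\<bar> \<le> 1 + D" using D(2)[of k] by linarith
    have "g k * h k - 1 = (g k - 1) * h k + (h k - 1)" by (simp add: algebra_simps)
    then have "\<bar>g k * h k - 1\<bar> \<le> \<bar>g k - 1\<bar> * \<bar>h k\<bar> + \<bar>h k - 1\<bar>"
      by (metis abs_mult abs_triangle_ineq)
    also have "\<dots> \<le> (C * q ^ k) * (1 + D) + D * q ^ k"
      using assms by (intro add_mono mult_mono C D h) (auto simp: C)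
    finally show ?thesis by (simp add: algebra_simps)
  qed
  moreover have "C * (1 + D) + D \<ge> 0" using C D by simp
  ultimately show ?thesis unfolding geom_close_def by blast
qed

lemma geom_close_prod:
  assumes "0 < q" "q < 1" "\<And>j. j \<in> A \<Longrightarrow> geom_close q (g j)"
  shows "geom_close q (\<lambda>k. \<Prod>j\<in>A. g j k)"
  using assms(3)
proof (induction A rule: infinite_finite_induct)
  case (insert j A)
  then show ?case using geom_close_mult[OF assms(1,2)] by simp
qed (auto simp: geom_close_def)

lemma geom_close_qpoch_inf:
  fixes x q :: real
  assumes "0 < q" "q < 1" "0 \<le> x" "x < 1"
  shows "geom_close q (\<lambda>k. qpoch_inf (x * q ^ k) q)"
    and "geom_close q (\<lambda>k. inverse (qpoch_inf (x * q ^ k) q))"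
proof -
  have xk: "0 \<le> x * q ^ k" "x * q ^ k \<le> x" "x * q ^ k < 1" "x * q ^ k \<le> q ^ k" for k
    using assms mult_left_le[of "q ^ k" x] mult_right_mono[of x 1 "q ^ k"]
    by (auto simp: power_le_one)
  have lo: "1 - qpoch_inf (x * q ^ k) q \<le> 1 / (1 - q) * q ^ k" for k
  proof -
    have "x * q ^ k / (1 - q) \<le> q ^ k / (1 - q)"
      using assms xk by (intro divide_right_mono) auto
    then show ?thesis
      using qpoch_inf_ge[OF assms(1,2) xk(1) xk(3)[of k]] by simp
  qed
  have up: "qpoch_inf (x * q ^ k) q \<le> 1" for k
    using qpoch_inf_le_1[OF assms(1,2) xk(1,3)] .
  have p: "0 < qpoch_inf x q" using assms by (intro qpoch_inf_pos)
  have px: "qpoch_inf x q \<le> qpoch_inf (x * q ^ k) q" for k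
    using assms xk by (intro qpoch_inf_antimono)
  show "geom_close q (\<lambda>k. qpoch_inf (x * q ^ k) q)"
    unfolding geom_close_def
  proof (intro exI[of _ "1 / (1 - q)"] conjI allI)
    show "\<bar>qpoch_inf (x * q ^ k) q - 1\<bar> \<le> 1 / (1 - q) * q ^ k" for k
      using lo[of k] up[of k] by linarith
  qed (use assms in simp)
  \<comment> \<open>1/p - 1 = (1 - p)/p, with numerator O(q^k) and denominator at least
    \<open>qpoch_inf x q\<close>.\<close>
  have "\<bar>inverse (qpoch_inf (x * q ^ k) q) - 1\<bar> \<le> (1 / (1 - q) / qpoch_inf x q) * q ^ k" for k
  proof -
    let ?p = "qpoch_inf (x * q ^ k) q"
    have pk: "0 < ?p" using p px[of k] by linarith
    have "\<bar>inverse ?p - 1\<bar> = (1 - ?p) / ?p"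
      using up[of k] pk by (simp add: field_simps abs_if)
    also have "\<dots> \<le> (1 / (1 - q) * q ^ k) / qpoch_inf x q"
      using lo[of k] px[of k] p up[of k] assms by (intro frac_le) auto
    finally show ?thesis by simp
  qed
  moreover have "1 / (1 - q) / qpoch_inf x q \<ge> 0" using p assms by simp
  ultimately show "geom_close q (\<lambda>k. inverse (qpoch_inf (x * q ^ k) q))"
    unfolding geom_close_def by blast
qed

text \<open>For parameters in [0,1) this is c(r,s;q) times the ratio of finite q-products in f, by
  (a;q)_k = (a;q)_inf / (a q^k;q)_inf. In this form every factor visibly tends to 1.\<close>

definition weight ::
    "real \<Rightarrow> nat \<Rightarrow> (nat \<Rightarrow> real) \<Rightarrow> nat \<Rightarrow> (nat \<Rightarrow> real) \<Rightarrow> nat \<Rightarrow> real" where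
  "weight q r a s b k =
     (\<Prod>j=1..s. qpoch_inf (b j * q ^ k) q) * (\<Prod>j=1..r. inverse (qpoch_inf (a j * q ^ k) q))"

lemma geom_close_weight:
  assumes "0 < q" "q < 1"
    and "\<And>j. j \<in> {1..r} \<Longrightarrow> 0 \<le> a j \<and> a j < 1"
    and "\<And>j. j \<in> {1..s} \<Longrightarrow> 0 \<le> b j \<and> b j < 1"
  shows "geom_close q (weight q r a s b)"
  unfolding weight_def [abs_def] using assms
  by (intro geom_close_mult geom_close_prod geom_close_qpoch_inf) auto

lemma cconst_pos:
  assumes "0 < q" "q < 1"
    and "\<And>j. j \<in> {1..r} \<Longrightarrow> 0 \<le> a j \<and> a j < 1"
    and "\<And>j. j \<in> {1..s} \<Longrightarrow> 0 \<le> b j \<and> b j < 1"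
  shows "0 < cconst q r a s b"
  unfolding cconst_def using assms by (intro divide_pos_pos prod_pos qpoch_inf_pos) auto

text \<open>\<open>x\<close> takes the place of q^(l k^2), which stands between numerator and
  denominator in \<open>qseries\<close>.\<close>

lemma qpoch_ratio_eq_weight:
  assumes "0 < q" "q < 1"
    and "\<And>j. j \<in> {1..r} \<Longrightarrow> 0 \<le> a j \<and> a j < 1"
    and "\<And>j. j \<in> {1..s} \<Longrightarrow> 0 \<le> b j \<and> b j < 1"
  shows "(\<Prod>j=1..r. qpoch (a j) q (int k)) * x / (\<Prod>j=1..s. qpoch (b j) q (int k))
    = weight q r a s b k * x / cconst q r a s b"
proof -
  have "(\<Prod>j=1..s. qpoch_inf (b j) q) > 0" "(\<Prod>j=1..r. qpoch_inf (a j) q) > 0"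
    using assms by (auto intro!: prod_pos qpoch_inf_pos)
  then show ?thesis
    by (simp add: qpoch_def weight_def cconst_def prod_dividef field_simps prod_inversef[symmetric])
qed

section \<open>Perturbed theta series\<close>

text \<open>A majorant of theta terms that is symmetric in j: an extra factor exp(d |j|) merely
  raises B by d.\<close>

definition gauss :: "real \<Rightarrow> real \<Rightarrow> int \<Rightarrow> real" where
  "gauss A B j = exp (B * \<bar>real_of_int j\<bar> - A * (real_of_int j)\<^sup>2)"

lemma gauss_mono: "B \<le> B' \<Longrightarrow> gauss A B j \<le> gauss A B' j"
  unfolding gauss_def by (simp add: mult_right_mono)

text \<open>The two half-lines give geometric series of ratio 1/e.\<close>

lemma summable_on_exp_minus_abs_int: "(\<lambda>j::int. exp (- \<bar>real_of_int j\<bar>)) summable_on UNIV"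
proof -
  let ?f = "\<lambda>j::int. exp (- \<bar>real_of_int j\<bar>)"
  have "(\<lambda>k::nat. exp (-1) ^ k :: real) summable_on UNIV"
    by (intro summable_nonneg_imp_summable_on summable_geometric) auto
  then have nat: "(\<lambda>k::nat. exp (- real k)) summable_on UNIV"
    by (simp flip: exp_of_nat_mult)
  have pos: "?f summable_on {0..}"
    using nat
    by (subst summable_on_reindex_bij_witness[where i=int and j=nat and T=UNIV
          and h="\<lambda>k::nat. exp (- real k)"])
       auto
  have "?f summable_on {..0}"
    using nat
    by (subst summable_on_reindex_bij_witness[where i="\<lambda>k. - int k" and j="\<lambda>j. nat (- j)" and T=UNIV
          and h="\<lambda>k::nat. exp (- real k)"])
       auto
  then have "?f summable_on {..<0}"
    by (rule summable_on_subset_banach) auto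
  then have "?f summable_on {0..} \<union> {..<0}"
    using pos by (intro summable_on_Un_disjoint) auto
  also have "{0..} \<union> {..<0} = (UNIV :: int set)" by auto
  finally show ?thesis .
qed

lemma summable_on_gauss:
  assumes "A > 0"
  shows "gauss A B summable_on UNIV"
proof (rule summable_on_comparison_test)
  let ?D = "(B + 1)\<^sup>2 / (4 * A)"
  show "(\<lambda>j::int. exp ?D * exp (- \<bar>real_of_int j\<bar>)) summable_on UNIV"
    by (intro summable_on_cmult_right summable_on_exp_minus_abs_int)
  fix j :: int
  let ?x = "\<bar>real_of_int j\<bar>"
  \<comment> \<open>Completing the square gives B x - A x^2 <= D - x, so that exp(-|j|) serves as a
    majorant up to a constant.\<close>
  have "0 \<le> (2 * A * ?x - (B + 1))\<^sup>2 / (4 * A)" using assms by simp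
  also have "\<dots> = A * ?x\<^sup>2 - (B + 1) * ?x + ?D"
    using assms by (simp add: field_simps power2_eq_square)
  finally have "B * ?x - A * ?x\<^sup>2 \<le> ?D - ?x" by (simp add: algebra_simps)
  then show "gauss A B j \<le> exp ?D * exp (- ?x)"
    unfolding gauss_def by (simp flip: exp_add)
  show "0 \<le> gauss A B j" unfolding gauss_def by simp
qed

section \<open>Terms of the theta series and their dependence on the exponent y\<close>

definition theta_term :: "real \<Rightarrow> real \<Rightarrow> complex \<Rightarrow> real \<Rightarrow> int \<Rightarrow> complex" where
  "theta_term q l u y j =
     of_real (q powr (l * (real_of_int j)\<^sup>2)) * (inverse u * of_real (q powr (l * y))) powi j"

lemma theta_eq_infsum_theta_term:
  assumes "0 < q"
  shows "theta (inverse u * of_real (q powr (l * y))) (q powr (2 * l)) =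
    (\<Sum>\<^sub>\<infinity>j. theta_term q l u y j)"
  unfolding theta_def theta_term_def by (simp add: powr_powr)

lemma powr_powi:
  fixes x a :: real
  assumes "0 < x"
  shows "(x powr a) powi j = x powr (a * real_of_int j)"
  using assms by (simp add: powr_powr flip: powr_real_of_int')

text \<open>The norm is the exponential of (l y ln q - ln |u|) j + l ln q j^2; the coefficient of j
  is bounded uniformly over |y| <= Y.\<close>

lemma norm_theta_term_le:
  assumes "0 < q" "q < 1" "0 < l" "u \<noteq> 0" "\<bar>y\<bar> \<le> Y"
  shows "cmod (theta_term q l u y j) \<le> gauss (- l * ln q) (\<bar>ln (cmod u)\<bar> - l * ln q * Y) j"
proof -
  let ?j = "real_of_int j"
  have u: "cmod u > 0" using assms by simp
  have "cmod (theta_term q l u y j) = q powr (l * ?j\<^sup>2) * (inverse (cmod u) * q powr (l * y)) powi j"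
    by (simp add: theta_term_def norm_mult norm_power_int norm_inverse)
  also have "inverse (cmod u) * q powr (l * y) = exp 1 powr (l * y * ln q - ln (cmod u))"
    using u assms by (simp add: powr_def exp_diff field_simps)
  also have "q powr (l * ?j\<^sup>2) * \<dots> powi j =
      exp ((l * y * ln q - ln (cmod u)) * ?j - (- l * ln q) * ?j\<^sup>2)"
    using assms by (subst powr_powi) (auto simp: powr_def exp_add[symmetric] algebra_simps)
  also have "\<dots> \<le> gauss (- l * ln q) (\<bar>ln (cmod u)\<bar> - l * ln q * Y) j"
  proof -
    have lnq: "- (l * ln q) \<ge> 0" using assms by (simp add: mult_nonneg_nonpos)
    have "\<bar>l * y * ln q\<bar> = - (l * ln q) * \<bar>y\<bar>" using assms by (simp add: abs_mult)
    also have "\<dots> \<le> - (l * ln q) * Y" using lnq assms by (intro mult_left_mono)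
    finally have "\<bar>l * y * ln q\<bar> \<le> - (l * ln q * Y)" by simp
    then have "\<bar>l * y * ln q - ln (cmod u)\<bar> \<le> \<bar>ln (cmod u)\<bar> - l * ln q * Y"
      using abs_triangle_ineq4[of "l * y * ln q" "ln (cmod u)"] by linarith
    then have "\<bar>l * y * ln q - ln (cmod u)\<bar> * \<bar>?j\<bar> \<le> (\<bar>ln (cmod u)\<bar> - l * ln q * Y) * \<bar>?j\<bar>"
      by (intro mult_right_mono) auto
    moreover have "(l * y * ln q - ln (cmod u)) * ?j \<le> \<bar>l * y * ln q - ln (cmod u)\<bar> * \<bar>?j\<bar>"
      by (metis abs_ge_self abs_mult)
    ultimately show ?thesis unfolding gauss_def by simp
  qed
  finally show ?thesis .
qed

lemma abs_exp_minus_1_le: "\<bar>exp x - 1\<bar> \<le> \<bar>x\<bar> * exp \<bar>x\<bar>" for x :: real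
proof (cases "x \<ge> 0")
  case True
  \<comment> \<open>Multiplying 1 - x <= exp (-x) by exp x gives exp x - 1 <= x exp x.\<close>
  have "exp x * (1 - x) \<le> exp x * exp (- x)"
    using exp_ge_add_one_self[of "- x"] by (intro mult_left_mono) auto
  then show ?thesis using True by (simp add: algebra_simps flip: exp_add)
next
  case False
  have "1 - exp x \<le> \<bar>x\<bar>" using exp_ge_add_one_self[of x] False by linarith
  also have "\<dots> \<le> \<bar>x\<bar> * exp \<bar>x\<bar>" by (simp add: mult_le_cancel_left1)
  finally show ?thesis using False by simp
qed

text \<open>Passing from y to y' multiplies the term by exp x with x = l (y' - y) ln q j, and |exp x
  - 1| <= |x| exp |x|. Here |x| supplies |y' - y|, and its factor |j| <= exp |j| raises B by 1; exp
  |x| raises B by 2 A Y, since |y' - y| <= 2 Y.\<close>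

lemma norm_theta_term_diff_le:
  assumes "0 < q" "q < 1" "0 < l" "u \<noteq> 0" "\<bar>y\<bar> \<le> Y" "\<bar>y'\<bar> \<le> Y"
  shows "cmod (theta_term q l u y' j - theta_term q l u y j)
    \<le> - l * ln q * \<bar>y' - y\<bar>
       * gauss (- l * ln q) (\<bar>ln (cmod u)\<bar> - l * ln q * Y + 1 - 2 * l * ln q * Y) j"
proof -
  define A where "A = - l * ln q"
  define B where "B = \<bar>ln (cmod u)\<bar> - l * ln q * Y"
  let ?j = "real_of_int j"
  define x where "x = l * (y' - y) * ln q * ?j"
  have A: "A > 0" unfolding A_def using assms by (simp add: mult_pos_neg)
  have "theta_term q l u y' j = theta_term q l u y j * of_real (exp x)"
  proof -
    define z w where "z = inverse u * complex_of_real (q powr (l * y))"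
      and "w = complex_of_real (q powr (l * (y' - y)))"
    have "q powr (l * y') = q powr (l * y) * q powr (l * (y' - y))"
      by (simp add: algebra_simps flip: powr_add)
    then have zw: "inverse u * of_real (q powr (l * y')) = z * w"
      unfolding z_def w_def by simp
    have "w powi j = of_real ((q powr (l * (y' - y))) powi j)"
      unfolding w_def by (rule of_real_power_int[symmetric])
    also have "(q powr (l * (y' - y))) powi j = exp x"
      using assms by (simp add: powr_powi) (simp add: powr_def x_def mult_ac)
    finally have w: "w powi j = of_real (exp x)" .
    have "(z * w) powi j = z powi j * w powi j" by (rule power_int_mult_distrib)
    then show ?thesis
      unfolding theta_term_def zw w z_def[symmetric] by (simp only: w mult.assoc)
  qed
  then have "theta_term q l u y' j - theta_term q l u y j = theta_term q l u y j * of_real (exp x - 1)"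
    by (simp add: algebra_simps)
  then have "cmod (theta_term q l u y' j - theta_term q l u y j)
      = cmod (theta_term q l u y j) * \<bar>exp x - 1\<bar>"
    by (metis norm_mult norm_of_real)
  also have "\<dots> \<le> gauss A B j * (\<bar>x\<bar> * exp \<bar>x\<bar>)"
    using norm_theta_term_le[OF assms(1-5)] abs_exp_minus_1_le[of x]
    unfolding A_def B_def by (intro mult_mono) (auto simp: gauss_def)
  also have "\<dots> \<le> gauss A B j * ((A * \<bar>y' - y\<bar> * exp \<bar>?j\<bar>) * exp (2 * A * Y * \<bar>?j\<bar>))"
  proof -
    have ax: "\<bar>x\<bar> = A * \<bar>y' - y\<bar> * \<bar>?j\<bar>"
      unfolding x_def A_def using assms by (simp add: abs_mult)
    have "\<bar>?j\<bar> \<le> exp \<bar>?j\<bar>" using exp_ge_add_one_self[of "\<bar>?j\<bar>"] by linarith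
    then have "\<bar>x\<bar> \<le> A * \<bar>y' - y\<bar> * exp \<bar>?j\<bar>"
      unfolding ax using A by (intro mult_left_mono) auto
    moreover have "\<bar>x\<bar> \<le> 2 * A * Y * \<bar>?j\<bar>"
    proof -
      have "\<bar>y' - y\<bar> \<le> 2 * Y" using assms by linarith
      then have "A * \<bar>y' - y\<bar> * \<bar>?j\<bar> \<le> A * (2 * Y) * \<bar>?j\<bar>"
        using A by (intro mult_right_mono mult_left_mono) auto
      then show ?thesis unfolding ax by simp
    qed
    ultimately show ?thesis
      using A by (intro mult_left_mono mult_mono) (auto simp: gauss_def)
  qed
  also have "\<dots> = A * \<bar>y' - y\<bar> * gauss A (B + 1 + 2 * A * Y) j"
    unfolding gauss_def by (simp add: algebra_simps flip: exp_add)
  finally show ?thesis unfolding A_def B_def by (simp add: algebra_simps)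
qed

section \<open>Comparing the weighted and truncated theta series with the full one\<close>

definition extend_by_zero :: "(nat \<Rightarrow> real) \<Rightarrow> int \<Rightarrow> real" where
  "extend_by_zero g i = (if i < 0 then 0 else g (nat i))"

text \<open>At negative i the deviation is exactly 1, which is at most q^i; the constant C + 1
  serves both signs of i.\<close>

lemma extend_by_zero_close:
  assumes "0 < q" "q < 1" "C \<ge> 0" "\<And>k. \<bar>g k - 1\<bar> \<le> C * q ^ k"
  shows "\<bar>extend_by_zero g i - 1\<bar> \<le> (C + 1) * q powr real_of_int i"
proof (cases "i < 0")
  case True
  have "1 \<le> q powr real_of_int i"
    using assms True powr_mono'[of "real_of_int i" 0 q] by simp
  also have "\<dots> \<le> (C + 1) * q powr real_of_int i"
    using assms by (simp add: mult_le_cancel_right1)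
  finally show ?thesis using True by (simp add: extend_by_zero_def)
next
  case False
  then have "q powr real_of_int i = q ^ nat i"
    using assms by (simp flip: powr_realpow)
  moreover have "C * q ^ nat i \<le> (C + 1) * q ^ nat i" using assms by (intro mult_right_mono) auto
  ultimately show ?thesis using assms(4)[of "nat i"] False by (simp add: extend_by_zero_def)
qed

lemma summable_on_theta_term:
  assumes "0 < q" "q < 1" "0 < l" "u \<noteq> 0"
  shows "(\<lambda>j. cmod (theta_term q l u y j)) summable_on UNIV"
proof (rule Infinite_Sum.abs_summable_on_comparison_test')
  show "gauss (- l * ln q) (\<bar>ln (cmod u)\<bar> - l * ln q * \<bar>y\<bar>) summable_on UNIV"
    using assms by (intro summable_on_gauss) (simp add: mult_pos_neg)
qed (use norm_theta_term_le[OF assms] in auto)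

lemma summable_on_extend_by_zero:
  assumes "0 < q" "q < 1" "0 < l" "u \<noteq> 0" "geom_close q g"
  shows "(\<lambda>j. cmod (of_real (extend_by_zero g (M - j)) * theta_term q l u y j)) summable_on UNIV"
proof -
  obtain C where C: "C \<ge> 0" "\<And>k. \<bar>g k - 1\<bar> \<le> C * q ^ k"
    using assms(5) unfolding geom_close_def by blast
  have "\<bar>extend_by_zero g i\<bar> \<le> 1 + C" for i
  proof (cases "i < 0")
    case False
    have "C * q ^ nat i \<le> C" using assms C by (simp add: mult_left_le power_le_one)
    then show ?thesis using C(2)[of "nat i"] False by (simp add: extend_by_zero_def)
  qed (use C in \<open>simp add: extend_by_zero_def\<close>)
  then have "cmod (of_real (extend_by_zero g (M - j)) * theta_term q l u y j)
      \<le> (1 + C) * cmod (theta_term q l u y j)" for j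
    unfolding norm_mult norm_of_real by (intro mult_right_mono) auto
  with summable_on_cmult_right[OF summable_on_theta_term[OF assms(1-4)]] show ?thesis
    by (rule Infinite_Sum.abs_summable_on_comparison_test')
qed

text \<open>Both error sources are estimated term by term against one Gaussian majorant, whose sum
  is finite. It depends only on q, l, u and Y, so K is chosen before M, y and y'.\<close>

lemma theta_remainder_bound:
  assumes "0 < q" "q < 1" "0 < l" "u \<noteq> 0" "geom_close q g"
  obtains K where "K > 0" "\<And>M y y'. \<bar>y\<bar> \<le> Y \<Longrightarrow> \<bar>y'\<bar> \<le> Y \<Longrightarrow>
    cmod ((\<Sum>\<^sub>\<infinity>j. of_real (extend_by_zero g (M - j)) * theta_term q l u y' j)
      - (\<Sum>\<^sub>\<infinity>j. theta_term q l u y j)) \<le> K * (q powr real_of_int M + \<bar>y' - y\<bar>)"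
proof -
  obtain C where C: "C \<ge> 0" "\<And>k. \<bar>g k - 1\<bar> \<le> C * q ^ k"
    using assms(5) unfolding geom_close_def by blast
  define A where "A = - l * ln q"
  define B where "B = \<bar>ln (cmod u)\<bar> - l * ln q * Y"
  \<comment> \<open>One coefficient for both errors: - ln q absorbs q^(-j) <= exp(- ln q |j|), and 1
    + 2 A |Y| absorbs the change of y. The absolute value is taken because Y carries no sign
    assumption.\<close>
  define B' where "B' = B + 1 + 2 * A * \<bar>Y\<bar> - ln q"
  have A: "A > 0" unfolding A_def using assms by (simp add: mult_pos_neg)
  have lnq: "ln q < 0" using assms by simp
  have BB': "B - ln q \<le> B'" "B + 1 + 2 * A * Y \<le> B'"
  proof -
    have "0 \<le> A * \<bar>Y\<bar>" "A * Y \<le> A * \<bar>Y\<bar>" using A by simp_all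
    then show "B - ln q \<le> B'" "B + 1 + 2 * A * Y \<le> B'" unfolding B'_def using lnq by auto
  qed
  define G where "G = gauss A B'"
  have G: "G summable_on UNIV" unfolding G_def using A by (rule summable_on_gauss)
  have G0: "G j \<ge> 0" for j by (simp add: G_def gauss_def)
  \<comment> \<open>The added 1 makes K positive as soon as the sum is nonnegative.\<close>
  define K where "K = (C + 1 + A) * infsum G UNIV + 1"
  have "infsum G UNIV \<ge> 0" by (rule infsum_nonneg) (use G0 in auto)
  then have K: "K > 0" unfolding K_def using A C by (simp add: add_nonneg_pos)
  have "cmod ((\<Sum>\<^sub>\<infinity>j. of_real (extend_by_zero g (M - j)) * theta_term q l u y' j)
      - (\<Sum>\<^sub>\<infinity>j. theta_term q l u y j)) \<le> K * (q powr real_of_int M + \<bar>y' - y\<bar>)"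
    if y: "\<bar>y\<bar> \<le> Y" "\<bar>y'\<bar> \<le> Y" for M y y'
  proof -
    let ?T = "theta_term q l u"
    let ?f = "\<lambda>j. of_real (extend_by_zero g (M - j)) * ?T y' j - ?T y j"
    let ?E = "q powr real_of_int M + \<bar>y' - y\<bar>"
    have bound: "cmod (?f j) \<le> (C + 1 + A) * ?E * G j" for j
    proof -
      \<comment> \<open>The first summand is the weight error including the missing tail, the second
        the effect of moving y to y'.\<close>
      have "?f j = of_real (extend_by_zero g (M - j) - 1) * ?T y' j + (?T y' j - ?T y j)"
        by (simp add: algebra_simps)
      then have "cmod (?f j) \<le> cmod (of_real (extend_by_zero g (M - j) - 1) * ?T y' j)
          + cmod (?T y' j - ?T y j)"
        by (metis norm_triangle_ineq)
      also have "\<dots> \<le> (C + 1) * q powr real_of_int M * G j + A * \<bar>y' - y\<bar> * G j"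
      proof (rule add_mono)
        have "cmod (of_real (extend_by_zero g (M - j) - 1) * ?T y' j)
            \<le> ((C + 1) * q powr real_of_int (M - j)) * gauss A B j"
          unfolding norm_mult norm_of_real A_def B_def
          using C assms y
          by (intro mult_mono extend_by_zero_close norm_theta_term_le) auto
        also have "q powr real_of_int (M - j) = q powr real_of_int M * q powr (- real_of_int j)"
          by (simp flip: powr_add)
        also have "(C + 1) * \<dots> * gauss A B j
            = (C + 1) * q powr real_of_int M * (q powr (- real_of_int j) * gauss A B j)"
          by (simp only: mult.assoc)
        also have "\<dots> \<le> (C + 1) * q powr real_of_int M * gauss A (B - ln q) j"
        proof (intro mult_left_mono)
          have "- real_of_int j * ln q \<le> \<bar>real_of_int j\<bar> * (- ln q)"
            using lnq abs_ge_self[of "real_of_int j"] by simp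
          then show "q powr (- real_of_int j) * gauss A B j \<le> gauss A (B - ln q) j"
            unfolding gauss_def powr_def using assms
            by (simp add: algebra_simps flip: exp_add)
        qed (use C in auto)
        also have "\<dots> \<le> (C + 1) * q powr real_of_int M * G j"
          unfolding G_def using BB' C by (intro mult_left_mono gauss_mono) auto
        finally show "cmod (of_real (extend_by_zero g (M - j) - 1) * ?T y' j)
            \<le> (C + 1) * q powr real_of_int M * G j" .
        have "cmod (?T y' j - ?T y j) \<le> A * \<bar>y' - y\<bar> * gauss A (B + 1 + 2 * A * Y) j"
          using norm_theta_term_diff_le[OF assms(1-4) y, of j]
          unfolding A_def B_def by (simp add: algebra_simps)
        also have "\<dots> \<le> A * \<bar>y' - y\<bar> * G j"
          unfolding G_def using BB' A by (intro mult_left_mono gauss_mono) auto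
        finally show "cmod (?T y' j - ?T y j) \<le> A * \<bar>y' - y\<bar> * G j" .
      qed
      also have "\<dots> = ((C + 1) * q powr real_of_int M + A * \<bar>y' - y\<bar>) * G j"
        by (simp add: algebra_simps)
      also have "\<dots> \<le> (C + 1 + A) * ?E * G j"
        using C A G0 by (intro mult_right_mono) (auto simp: algebra_simps)
      finally show ?thesis .
    qed
    have sum_G: "(\<lambda>j. (C + 1 + A) * ?E * G j) summable_on UNIV"
      using G by (rule summable_on_cmult_right)
    have abs_f: "(\<lambda>j. cmod (?f j)) summable_on UNIV"
      by (rule Infinite_Sum.abs_summable_on_comparison_test'[OF sum_G bound])
    note has_sum_infsum[OF abs_summable_summable[OF summable_on_extend_by_zero[OF assms]], of M y']
    moreover note has_sum_uminusI
      [OF has_sum_infsum[OF abs_summable_summable[OF summable_on_theta_term[OF assms(1-4)]]], of y]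
    ultimately have "((\<lambda>j. of_real (extend_by_zero g (M - j)) * ?T y' j + - ?T y j) has_sum
        ((\<Sum>\<^sub>\<infinity>j. of_real (extend_by_zero g (M - j)) * ?T y' j) + - (\<Sum>\<^sub>\<infinity>j. ?T y j))) UNIV"
      by (rule has_sum_add)
    from infsumI[OF this] have "(\<Sum>\<^sub>\<infinity>j. of_real (extend_by_zero g (M - j)) * ?T y' j) - (\<Sum>\<^sub>\<infinity>j. ?T y j) = (\<Sum>\<^sub>\<infinity>j. ?f j)"
      by simp
    also have "cmod \<dots> \<le> (\<Sum>\<^sub>\<infinity>j. cmod (?f j))"
      using abs_f by (rule norm_infsum_bound)
    also have "\<dots> \<le> (\<Sum>\<^sub>\<infinity>j. (C + 1 + A) * ?E * G j)"
      by (rule infsum_mono[OF abs_f sum_G bound])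
    also have "\<dots> = (K - 1) * ?E"
      using G by (simp add: infsum_cmult_right K_def)
    also have "\<dots> \<le> K * ?E" by (intro mult_right_mono) auto
    finally show ?thesis .
  qed
  with K show ?thesis using that by blast
qed

text \<open>The substitution k = M - j, valid for any natural M; \<open>x\<close> stands for n t.
  The choice of M near x / 2 only matters later, when x - 2 M has to stay bounded.\<close>

lemma qseries_eq_theta_sum:
  assumes "0 < q" "q < 1" "0 < l" "u \<noteq> 0"
    and "\<And>j. j \<in> {1..r} \<Longrightarrow> 0 \<le> a j \<and> a j < 1"
    and "\<And>j. j \<in> {1..s} \<Longrightarrow> 0 \<le> b j \<and> b j < 1"
  shows "qseries q l r a s b (of_real (q powr (- l * x)) * u) =
    u ^ M * (\<Sum>\<^sub>\<infinity>j. of_real (extend_by_zero (weight q r a s b) (int M - j))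
               * theta_term q l u (x - 2 * real M) j)
      / of_real (cconst q r a s b * q powr (l * real M * (x - real M)))"
proof -
  define c where "c = cconst q r a s b"
  define g where "g = weight q r a s b"
  have c: "c > 0" unfolding c_def using assms by (intro cconst_pos)
  have geom: "geom_close q g" unfolding g_def using assms by (intro geom_close_weight)
  let ?T = "\<lambda>j. of_real (extend_by_zero g (int M - j)) * theta_term q l u (x - 2 * real M) j"
  let ?D = "complex_of_real (c * q powr (l * real M * (x - real M)))"
  let ?F = "\<lambda>k. of_real (g k * q powr (l * (real k)\<^sup>2) / c) * (of_real (q powr (- l * x)) * u) ^ k"
  have F: "?F k = u ^ M / ?D * ?T (int M - int k)" for k
  proof -
    define j where "j = int M - int k"
    have k: "real k = real M - real_of_int j" "int k = int M - j" by (simp_all add: j_def)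
    have "u ^ k = u powi (int M - j)" by (simp flip: k(2))
    also have "\<dots> = u ^ M * inverse u powi j"
      using assms by (simp add: power_int_diff power_int_inverse field_simps)
    finally have uk: "u ^ k = u ^ M * inverse u powi j" .
    have "(q powr (- l * x)) ^ k = q powr (- l * x * real k)"
      using assms powr_realpow[of "q powr (- l * x)" k] by (simp add: powr_powr)
    then have "q powr (l * (real k)\<^sup>2) * (q powr (- l * x)) ^ k = q powr (l * (real k)\<^sup>2 - l * x * real k)"
      by (simp flip: powr_add)
    \<comment> \<open>The square recentred at M: the part free of j becomes the prefactor, the part
      linear in j the argument of the theta term.\<close>
    also have "l * (real k)\<^sup>2 - l * x * real k
        = l * (real_of_int j)\<^sup>2 + l * (x - 2 * real M) * real_of_int j - l * real M * (x - real M)"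
      unfolding k(1) by (simp add: algebra_simps power2_eq_square)
    also have "q powr \<dots> = q powr (l * (real_of_int j)\<^sup>2)
        * (q powr (l * (x - 2 * real M))) powi j / q powr (l * real M * (x - real M))"
      using assms by (simp add: powr_powi powr_diff powr_add)
    finally have qk: "q powr (l * (real k)\<^sup>2) * (q powr (- l * x)) ^ k = \<dots>" .
    have "?F k = of_real (g k / c) * u ^ k * of_real (q powr (l * (real k)\<^sup>2) * (q powr (- l * x)) ^ k)"
      by (simp add: power_mult_distrib)
    also have "\<dots> = u ^ M / ?D * (of_real (g k) * theta_term q l u (x - 2 * real M) j)"
      unfolding uk qk theta_term_def
      by (simp add: power_int_mult_distrib of_real_power_int)
    finally have "?F k = u ^ M / ?D * (of_real (g k) * theta_term q l u (x - 2 * real M) j)" .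
    moreover have "extend_by_zero g (int M - j) = g k" by (simp add: extend_by_zero_def j_def)
    ultimately show ?thesis unfolding j_def by metis
  qed
  have T: "?T summable_on UNIV"
    by (rule abs_summable_summable[OF summable_on_extend_by_zero[OF assms(1-4) geom]])
  then have "(?T has_sum (\<Sum>\<^sub>\<infinity>j. ?T j)) UNIV" by (rule has_sum_infsum)
  \<comment> \<open>The extended weight vanishes for j > M, so the sum over all integers is the one
    over k = M - j >= 0.\<close>
  also have "?this \<longleftrightarrow> (?T has_sum (\<Sum>\<^sub>\<infinity>j. ?T j)) {..int M}"
    by (rule has_sum_cong_neutral) (auto simp: extend_by_zero_def)
  also have "\<dots> \<longleftrightarrow> ((\<lambda>k::nat. ?T (int M - int k)) has_sum (\<Sum>\<^sub>\<infinity>j. ?T j)) UNIV"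
    by (rule has_sum_reindex_bij_witness[where i="\<lambda>k. int M - int k" and j="\<lambda>j. nat (int M - j)"])
       auto
  finally have "(\<lambda>k. ?T (int M - int k)) sums (\<Sum>\<^sub>\<infinity>j. ?T j)"
    by (rule has_sum_imp_sums)
  then have "(\<lambda>k. u ^ M / ?D * ?T (int M - int k)) sums (u ^ M / ?D * (\<Sum>\<^sub>\<infinity>j. ?T j))"
    by (rule sums_mult)
  then have "?F sums (u ^ M / ?D * (\<Sum>\<^sub>\<infinity>j. ?T j))" unfolding F .
  then have "(\<Sum>k. ?F k) = u ^ M / ?D * (\<Sum>\<^sub>\<infinity>j. ?T j)" by (rule sums_unique[symmetric])
  moreover have "qseries q l r a s b (of_real (q powr (- l * x)) * u) = (\<Sum>k. ?F k)"
    unfolding qseries_def g_def c_def using assms by (subst qpoch_ratio_eq_weight) auto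
  ultimately show ?thesis unfolding g_def c_def by simp
qed

section \<open>Diophantine approximation\<close>

text \<open>Only finitely many k occur, and for each the distance from k t to the nearest integer is
  positive. This later forces the denominators of good approximations to be large.\<close>

lemma irrational_multiples_gap:
  fixes t :: real
  assumes "t \<notin> \<rat>"
  obtains \<delta> where "\<delta> > 0" "\<And>k h :: int. 0 < k \<Longrightarrow> k \<le> int K \<Longrightarrow> \<delta> \<le> \<bar>of_int k * t - of_int h\<bar>"
proof -
  let ?d = "\<lambda>k::int. \<bar>of_int k * t - of_int (round (of_int k * t))\<bar>"
  \<comment> \<open>The inserted 1 keeps the set nonempty when K = 0.\<close>
  define \<delta> where "\<delta> = Min (insert 1 (?d ` {1..int K}))"
  have "?d k > 0" if "0 < k" for k :: int
  proof (rule ccontr)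
    assume "\<not> ?d k > 0"
    then have "t = of_int (round (of_int k * t)) / of_int k"
      using that by (simp add: field_simps)
    then have "t \<in> \<rat>" by (metis Rats_divide Rats_of_int)
    with assms show False by blast
  qed
  then have "\<delta> > 0" unfolding \<delta>_def by (subst Min_gr_iff) auto
  moreover have "\<delta> \<le> \<bar>of_int k * t - of_int h\<bar>" if "0 < k" "k \<le> int K" for k h :: int
  proof -
    have "\<delta> \<le> ?d k" unfolding \<delta>_def using that by (intro Min_le) auto
    also have "\<dots> \<le> \<bar>of_int k * t - of_int h\<bar>" by (rule round_diff_minimal)
    finally show ?thesis .
  qed
  ultimately show ?thesis using that by blast
qed

text \<open>If \<open>h / k\<close> is a Dirichlet approximation of \<open>t\<close> and \<open>N\<close> the integer nearest to \<open>k * \<beta>\<close>, then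
  \<open>n * h - m * k = N\<close> has a solution with \<open>n\<close> between \<open>k / 2\<close> and \<open>3 * k / 2\<close>; the error
  is at most \<open>(n / k + 1 / 2) / k \<le> 2 / k \<le> 3 / n\<close>.\<close>

lemma inhomogeneous_approximation:
  fixes t \<beta> :: real
  assumes "t \<notin> \<rat>"
  obtains n m :: int where "n > int N0" "\<bar>of_int n * t - of_int m - \<beta>\<bar> \<le> 3 / of_int n"
proof -
  \<comment> \<open>The range 2 N0 anticipates n >= k / 2: excluding k <= 2 N0 gives n > N0.\<close>
  obtain \<delta> where \<delta>: "\<delta> > 0"
    "\<And>k h :: int. 0 < k \<Longrightarrow> k \<le> int (2 * N0) \<Longrightarrow> \<delta> \<le> \<bar>of_int k * t - of_int h\<bar>"
    using irrational_multiples_gap[OF assms] by blast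
  \<comment> \<open>A Dirichlet error below 1 / N < \<delta> rules out every denominator up to 2
    N0.\<close>
  obtain N :: nat where N: "N > 0" "1 / real N < \<delta>"
    using \<delta>(1) nat_approx_posE by (metis zero_less_Suc)
  obtain h k :: int where hk: "coprime h k" "0 < k" "k \<le> int N" "\<bar>of_int k * t - of_int h\<bar> < 1 / N"
    using Dirichlet_approx_coprime[OF N(1)] by metis
  have k_big: "k > int (2 * N0)"
    using \<delta>(2)[of k h] hk N by force
  have "1 / real N \<le> 1 / of_int k"
    using hk by (intro divide_left_mono) auto
  then have err: "\<bar>of_int k * t - of_int h\<bar> \<le> 1 / of_int k" using hk by linarith
  define B where "B = round (of_int k * \<beta>)"
  have B: "\<bar>of_int B - of_int k * \<beta>\<bar> \<le> 1 / 2"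
    unfolding B_def by (rule of_int_round_abs_le)
  \<comment> \<open>Modulo k, v is inverse to h, so n = v B solves n h = B.\<close>
  obtain v w where vw: "v * h + w * k = 1"
    using bezout_int[of h k] hk by auto
  \<comment> \<open>c is k / 2 rounded up. The representative of v B modulo k is taken among c, ...,
    c + k - 1, whence k / 2 <= n <= 3 k / 2.\<close>
  define c where "c = (k + 1) div 2"
  have c: "k \<le> 2 * c" "2 * c \<le> k + 1" unfolding c_def by presburger+
  define e where "e = (v * B - c) mod k"
  define n where "n = c + e"
  have e: "0 \<le> e" "e \<le> k - 1" unfolding e_def using hk by auto
  have n: "k \<le> 2 * n" "2 * n \<le> 3 * k"
    unfolding n_def using e c by auto
  have "k dvd n - v * B"
  proof -
    have "n - v * B = - (k * ((v * B - c) div k))"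
      unfolding n_def e_def using mult_div_mod_eq[of k "v * B - c"] by linarith
    then show ?thesis by simp
  qed
  then have "k dvd (n - v * B) * h" by simp
  moreover have "(n - v * B) * h = n * h - B + w * B * k"
    using arg_cong[OF vw, of "\<lambda>z. z * B"] by (simp add: algebra_simps)
  ultimately have "k dvd n * h - B" by (simp add: dvd_add_left_iff)
  then obtain m where "n * h - B = k * m" by (rule dvdE)
  then have m: "of_int n * of_int h - of_int B = of_int k * (of_int m :: real)"
    by (metis of_int_diff of_int_mult)
  \<comment> \<open>With n h - k m = B, the scaled error splits into n times the Dirichlet error and
    the rounding error of k \<beta>.\<close>
  have "of_int k * (of_int n * t - of_int m - \<beta>)
      = of_int n * (of_int k * t - of_int h) + (of_int B - of_int k * \<beta>)"
    using m by (simp add: algebra_simps)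
  then have "\<bar>of_int k * (of_int n * t - of_int m - \<beta>)\<bar>
      \<le> \<bar>of_int n\<bar> * \<bar>of_int k * t - of_int h\<bar> + \<bar>of_int B - of_int k * \<beta>\<bar>"
    by (metis abs_mult abs_triangle_ineq)
  also have "\<dots> \<le> \<bar>of_int n\<bar> * (1 / of_int k) + 1 / 2"
    by (intro add_mono mult_left_mono err B) auto
  also have "\<dots> \<le> 2"
  proof -
    have "2 * real_of_int n \<le> 3 * real_of_int k" using n by linarith
    then show ?thesis using n hk by (simp add: field_simps)
  qed
  finally have "of_int k * \<bar>of_int n * t - of_int m - \<beta>\<bar> \<le> 2"
    using hk by (simp add: abs_mult)
  then have "\<bar>of_int n * t - of_int m - \<beta>\<bar> \<le> 2 / of_int k"
    using hk by (simp add: field_simps)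
  also have "\<dots> \<le> 3 / of_int n"
  proof -
    have "2 * real_of_int n \<le> 3 * real_of_int k" using n by linarith
    moreover have "n > 0" using n hk by linarith
    ultimately show ?thesis using hk by (simp add: field_simps)
  qed
  finally have "\<bar>of_int n * t - of_int m - \<beta>\<bar> \<le> 3 / of_int n" .
  moreover have "n > int N0" using n k_big by linarith
  ultimately show ?thesis using that by blast
qed

text \<open>Finiteness would bound the first coordinates, while approximations exist with n beyond
  any bound.\<close>

lemma infinite_inhomogeneous_approximations:
  fixes t \<beta> :: real
  assumes "t > 0" "t \<notin> \<rat>"
  shows "infinite {(n::nat, m::nat). n > 0 \<and> m > 0 \<and>
    (\<exists>\<gamma>::real. real n * t = real m + \<beta> + \<gamma> \<and> \<bar>\<gamma>\<bar> \<le> 3 / real n)}" (is "infinite ?S")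
proof
  assume "finite ?S"
  then have "finite (fst ` ?S)" by simp
  then have "\<exists>L. \<forall>n\<in>fst ` ?S. n \<le> L"
    by (simp only: finite_nat_set_iff_bounded_le)
  then obtain L where L: "\<forall>n\<in>fst ` ?S. n \<le> L" ..
  \<comment> \<open>For n > N1 the product n t exceeds |\<beta>| + 3, while n t - m - \<beta> is at
    most 3; this forces m > 0.\<close>
  obtain N1 :: nat where N1: "(\<bar>\<beta>\<bar> + 3) / t < real N1"
    using reals_Archimedean2 by blast
  obtain n m :: int where nm: "n > int (max L N1)" "\<bar>of_int n * t - of_int m - \<beta>\<bar> \<le> 3 / of_int n"
    using inhomogeneous_approximation[OF assms(2)] by blast
  have n: "n \<ge> 1" "real_of_int n > real N1" "int L < n" using nm by linarith+
  have "3 / real_of_int n \<le> 3" using n by (simp add: field_simps)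
  moreover have "of_int n * t > \<bar>\<beta>\<bar> + 3"
    using N1 n(2) assms(1) by (smt (verit) divide_less_eq mult_strict_right_mono)
  ultimately have "real_of_int m > 0" using nm by linarith
  then have m: "m > 0" by simp
  have "(nat n, nat m) \<in> ?S"
    using nm n m by (auto intro!: exI[of _ "of_int n * t - of_int m - \<beta>"])
  then have "fst (nat n, nat m) \<in> fst ` ?S" by (rule imageI)
  with L have "fst (nat n, nat m) \<le> L" by (rule bspec)
  with n show False by simp
qed

text \<open>If t = p / d, adding a multiple of d to n moves n t by an integer and keeps its
  fractional part.\<close>

lemma infinite_frac_multiples:
  fixes t lam :: real
  assumes "t > 0" "t \<in> \<rat>" "lam \<in> frac_multiples t"
  shows "infinite {(n::nat, m::nat). n > 0 \<and> m > 0 \<and> t * real n = real m + lam}" (is "infinite ?S")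
proof
  assume "finite ?S"
  then have "finite (fst ` ?S)" by simp
  then have "\<exists>L. \<forall>n\<in>fst ` ?S. n \<le> L"
    by (simp only: finite_nat_set_iff_bounded_le)
  then obtain L where L: "\<forall>n\<in>fst ` ?S. n \<le> L" ..
  obtain n0 :: nat where n0: "n0 > 0" "lam = frac (real n0 * t)"
    using assms(3) unfolding frac_multiples_def by blast
  obtain p d :: nat where pd: "d \<noteq> 0" "t = real p / real d"
    using Rats_abs_nat_div_natE[OF assms(2)] assms(1) by (metis abs_of_pos)
  have p: "p > 0" using pd assms(1) by (cases p) auto
  \<comment> \<open>The factor \<open>Suc L\<close> pushes n beyond L; since p > 0, it also makes m
    positive when the floor of n0 t is 0.\<close>
  define n where "n = n0 + Suc L * d"
  define m where "m = nat \<lfloor>real n0 * t\<rfloor> + Suc L * p"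
  have fl: "\<lfloor>real n0 * t\<rfloor> \<ge> 0" using assms(1) by simp
  have "t * real n = t * real n0 + real (Suc L) * (t * real d)"
    unfolding n_def by (simp add: algebra_simps)
  also have "t * real d = real p" using pd by simp
  also have "t * real n0 = of_int \<lfloor>real n0 * t\<rfloor> + lam"
    unfolding n0 frac_def by (simp add: mult.commute)
  also have "real_of_int \<lfloor>real n0 * t\<rfloor> = real (nat \<lfloor>real n0 * t\<rfloor>)" using fl by simp
  finally have "t * real n = real m + lam" unfolding m_def by (simp add: algebra_simps)
  then have "(n, m) \<in> ?S" using n0 p by (auto simp: n_def m_def)
  then have "fst (n, m) \<in> fst ` ?S" by (rule imageI)
  with L have "fst (n, m) \<le> L" by (rule bspec)
  moreover have "L < Suc L * d" using pd by (cases d) auto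
  ultimately show False by (simp add: n_def del: mult_Suc)
qed

section \<open>Remainder estimates\<close>

text \<open>All terms are nonnegative and the one at index 0 is 1. Positivity makes the prefactors
  of the asserted bounds positive, so that they can eventually dominate any constant.\<close>

lemma theta_pos:
  assumes "0 < q" "q < 1" "0 < l" "u \<noteq> 0"
  shows "0 < theta (inverse (cmod u)) (q powr l)"
proof -
  let ?f = "\<lambda>j::int. (q powr l) powr ((real_of_int j)\<^sup>2 / 2) * inverse (cmod u) powi j"
  have f: "?f j = cmod (theta_term q (l / 2) u 0 j)" for j
    using assms
    by (simp add: theta_term_def norm_mult norm_power_int norm_inverse powr_powr)
  have "?f summable_on UNIV"
    unfolding f using assms by (intro summable_on_theta_term) auto
  then have "sum ?f {0} \<le> infsum ?f UNIV"
    by (rule finite_sum_le_infsum) (auto simp: f)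
  then show ?thesis using assms unfolding theta_def by simp
qed

text \<open>Hence n t - 2 M equals chi(m) + lam as soon as n t = m + lam, where M is
  \<open>m div 2\<close>.\<close>

lemma real_chi: "real_of_int (chi (int m)) = real m - 2 * real (m div 2)"
proof -
  have "\<lfloor>real_of_int (int m) / 2\<rfloor> = int (m div 2)"
    using floor_divide_of_int_eq[of "int m" 2] by (simp add: zdiv_int)
  then show ?thesis unfolding chi_def by simp
qed

text \<open>chi(m) <= 1, x < 1 and |\<gamma>| <= 3 / n <= 3 add up to at most 5, the common bound Y
  for the exponents.\<close>

lemma abs_chi_add_le:
  assumes "0 \<le> x" "x < 1" "\<bar>\<gamma>\<bar> \<le> 3"
  shows "\<bar>real_of_int (chi (int m)) + x\<bar> \<le> 5" "\<bar>real_of_int (chi (int m)) + x + \<gamma>\<bar> \<le> 5"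
proof -
  have "real m - 2 * real (m div 2) = real (m mod 2)"
    using mult_div_mod_eq[of 2 m] by (metis add_diff_cancel_left' of_nat_add of_nat_mult of_nat_numeral)
  then have "0 \<le> real_of_int (chi (int m))" "real_of_int (chi (int m)) \<le> 1"
    unfolding real_chi by (auto simp: mod2_eq_if)
  then show "\<bar>real_of_int (chi (int m)) + x\<bar> \<le> 5" "\<bar>real_of_int (chi (int m)) + x + \<gamma>\<bar> \<le> 5"
    using assms by linarith+
qed

lemma powr_div_2_le:
  assumes "0 < q" "q < 1"
  shows "q powr real_of_int (int (m div 2)) \<le> q powr (real m / 2 - 1 / 2)"
proof -
  have "m \<le> 2 * (m div 2) + 1" by presburger
  then have "real m \<le> 2 * real (m div 2) + 1" by linarith
  then show ?thesis using assms by (intro powr_mono') auto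
qed

section \<open>Decay of q^M against the asserted bounds\<close>

lemma tendsto_times_powr_linear:
  assumes "0 < q" "q < 1" "0 < t"
  shows "(\<lambda>n. real n * q powr (t * real n - c)) \<longlonglongrightarrow> 0"
proof -
  have "q powr t < 1" using assms powr_less_mono'[of q 0 t] by simp
  then have "(\<lambda>n. real n * (q powr t) ^ n) \<longlonglongrightarrow> 0"
    using assms by (intro powser_times_n_limit_0) auto
  then have "(\<lambda>n. real n * (q powr t) ^ n * q powr (- c)) \<longlonglongrightarrow> 0 * q powr (- c)"
    by (intro tendsto_mult tendsto_const)
  moreover have "real n * (q powr t) ^ n * q powr (- c) = real n * q powr (t * real n - c)" for n
    using assms powr_realpow[of "q powr t" n] by (simp add: powr_powr powr_diff powr_minus divide_inverse)
  ultimately show ?thesis by simp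
qed

lemma eventually_powr_linear_le:
  assumes "0 < q" "q < 1" "0 < t" "0 < (D :: real)"
  shows "\<forall>\<^sub>F n in sequentially. real n * q powr (t * real n - c) \<le> D"
  using order_tendstoD(2)[OF tendsto_times_powr_linear[OF assms(1-3), of c] assms(4)]
  by (rule eventually_mono) simp

text \<open>q^M is at most q^(m/4 - 1/2) q^(m/4), and the first factor tends to 0 because m > t n -
  1. The offset 3/4 is 1/2 + 1/4, the latter from lam < 1.\<close>

lemma rational_remainder_eventually_le:
  assumes "0 < q" "q < 1" "0 < t" "lam < 1" "0 < K" "0 < (D :: real)"
  shows "\<forall>\<^sub>F n in sequentially. \<forall>m::nat. t * real n = real m + lam \<longrightarrow>
    K * q powr real_of_int (int (m div 2)) \<le> D * q powr (real m / 4)"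
proof -
  have "\<forall>\<^sub>F n in sequentially. real n * q powr ((t / 4) * real n - 3 / 4) \<le> D / K"
    using assms by (intro eventually_powr_linear_le) auto
  then show ?thesis using eventually_ge_at_top[of 1]
  proof eventually_elim
    case (elim n)
    show ?case
    proof (intro allI impI)
      fix m :: nat
      assume m: "t * real n = real m + lam"
      have "q powr (real m / 4 - 1 / 2) \<le> q powr ((t / 4) * real n - 3 / 4)"
      proof (rule powr_mono')
        show "(t / 4) * real n - 3 / 4 \<le> real m / 4 - 1 / 2"
          using m assms(4) by (simp add: field_simps)
      qed (use assms in auto)
      also have "\<dots> \<le> real n * q powr ((t / 4) * real n - 3 / 4)"
        using elim by (simp add: mult_le_cancel_right1)
      also have "\<dots> \<le> D / K" by (rule elim)
      finally have *: "K * q powr (real m / 4 - 1 / 2) \<le> D"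
        using assms by (simp add: field_simps)
      have "K * q powr real_of_int (int (m div 2)) \<le> K * q powr (real m / 2 - 1 / 2)"
        using assms powr_div_2_le by (intro mult_left_mono) auto
      also have "\<dots> = K * q powr (real m / 4 - 1 / 2) * q powr (real m / 4)"
        by (simp flip: powr_add)
      also have "\<dots> \<le> D * q powr (real m / 4)"
        using * by (intro mult_right_mono) auto
      finally show "K * q powr real_of_int (int (m div 2)) \<le> D * q powr (real m / 4)" .
    qed
  qed
qed

text \<open>After multiplication by n the error is at most 4 K: eventually n q^M <= 1, and n
  |\<gamma>| <= 3. Finally D log n exceeds 4 K. The offset 5/2 is (1 + \<beta> + \<gamma>) / 2 at
  its largest.\<close>

lemma irrational_remainder_eventually_le:
  assumes "0 < q" "q < 1" "0 < t" "\<beta> < 1" "0 < K" "0 < (D :: real)"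
  shows "\<forall>\<^sub>F n in sequentially. \<forall>(m::nat) \<gamma>. n > 0 \<and> real n * t = real m + \<beta> + \<gamma> \<and> \<bar>\<gamma>\<bar> \<le> 3 / real n \<longrightarrow>
    K * (q powr real_of_int (int (m div 2)) + \<bar>\<gamma>\<bar>) \<le> D * (ln (real n) / real n)"
proof -
  have "filterlim (\<lambda>n. ln (real n)) at_top sequentially"
    by (rule filterlim_compose[OF ln_at_top filterlim_real_sequentially])
  then have ln_ev: "\<forall>\<^sub>F n in sequentially. 4 * K / D \<le> ln (real n)"
    unfolding filterlim_at_top by blast
  have "\<forall>\<^sub>F n in sequentially. real n * q powr ((t / 2) * real n - 5 / 2) \<le> 1"
    using assms by (intro eventually_powr_linear_le) auto
  then show ?thesis using ln_ev eventually_ge_at_top[of 1]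
  proof eventually_elim
    case (elim n)
    show ?case
    proof (intro allI impI)
      fix m :: nat and \<gamma> :: real
      assume m: "n > 0 \<and> real n * t = real m + \<beta> + \<gamma> \<and> \<bar>\<gamma>\<bar> \<le> 3 / real n"
      have "3 / real n \<le> 3" using elim by (simp add: field_simps)
      then have \<gamma>: "\<gamma> \<le> 3" using m by linarith
      have "q powr (real m / 2 - 1 / 2) \<le> q powr ((t / 2) * real n - 5 / 2)"
      proof (rule powr_mono')
        show "(t / 2) * real n - 5 / 2 \<le> real m / 2 - 1 / 2"
          using m assms(4) \<gamma> by (simp add: field_simps)
      qed (use assms in auto)
      then have "real n * q powr real_of_int (int (m div 2)) \<le> real n * q powr ((t / 2) * real n - 5 / 2)"
        using powr_div_2_le[OF assms(1,2), of m] by (intro mult_left_mono) auto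
      also have "\<dots> \<le> 1" by (rule elim)
      finally have "real n * q powr real_of_int (int (m div 2)) \<le> 1" .
      moreover have "real n * \<bar>\<gamma>\<bar> \<le> 3" using m by (auto simp: pos_le_divide_eq mult.commute)
      ultimately have "K * (real n * q powr real_of_int (int (m div 2)) + real n * \<bar>\<gamma>\<bar>) \<le> K * 4"
        using assms by (intro mult_left_mono) auto
      also have "\<dots> \<le> D * ln (real n)"
        using elim assms by (simp add: field_simps)
      finally show "K * (q powr real_of_int (int (m div 2)) + \<bar>\<gamma>\<bar>) \<le> D * (ln (real n) / real n)"
        using m by (simp add: field_simps)
    qed
  qed
qed

section \<open>The expansions along rational and irrational t\<close>

theorem theorem3p1:
  fixes q l :: real and r s :: nat and a b :: "nat \<Rightarrow> real" and u :: complex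
  assumes "0 < q" and "q < 1" and "0 < l"
    and "\<And>j. j \<in> {1..r} \<Longrightarrow> 0 \<le> a j \<and> a j < 1"
    and "\<And>j. j \<in> {1..s} \<Longrightarrow> 0 \<le> b j \<and> b j < 1"
    and "u \<noteq> 0"
  shows
   "(\<forall>t lam :: real. t > 0 \<and> t \<in> \<rat> \<and> lam \<in> frac_multiples t \<longrightarrow>
       infinite {(n::nat, m::nat). n > 0 \<and> m > 0 \<and> t * real n = real m + lam} \<and>
       (\<exists>rem :: nat \<Rightarrow> complex.
          (\<forall>n m :: nat. n > 0 \<and> m > 0 \<and> t * real n = real m + lam \<longrightarrow>
             qseries q l r a s b (of_real (q powr (- l * real n * t)) * u) =
               u ^ (m div 2) *
               (theta (inverse u * of_real (q powr (l * chi (int m) + l * lam))) (q powr (2 * l))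
                 + rem n)
               / of_real (cconst q r a s b *
                    q powr (l * real (m div 2) * (real n * t - real (m div 2))))) \<and>
          (\<forall>\<^sub>F n in sequentially. \<forall>m :: nat. n > 0 \<and> m > 0 \<and> t * real n = real m + lam \<longrightarrow>
             cmod (rem n) \<le>
               (2 / (1 - q)) ^ (r + s + 1) *
               ((\<Prod>j=1..s. qpoch_inf (- b j * q ^ 2) q) * theta (inverse (cmod u)) (q powr l)
                 / (\<Prod>j=1..r. qpoch_inf (a j) q)) *
               (q powr (real m / 4)
                 + q powr (l * real m ^ 2 / 16) / cmod u ^ (m div 4 + 1)))))
    \<and>
    (\<forall>t \<beta> :: real. t > 0 \<and> t \<notin> \<rat> \<and> 0 \<le> \<beta> \<and> \<beta> < 1 \<longrightarrow>
       infinite {(n::nat, m::nat). n > 0 \<and> m > 0 \<and>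
         (\<exists>\<gamma>::real. real n * t = real m + \<beta> + \<gamma> \<and> \<bar>\<gamma>\<bar> \<le> 3 / real n)} \<and>
       (\<exists>e :: nat \<Rightarrow> nat \<Rightarrow> complex.
          (\<forall>(n::nat) (m::nat) \<gamma>::real. n > 0 \<and> m > 0 \<and>
              real n * t = real m + \<beta> + \<gamma> \<and> \<bar>\<gamma>\<bar> \<le> 3 / real n \<longrightarrow>
             qseries q l r a s b (of_real (q powr (- l * real n * t)) * u) =
               u ^ (m div 2) *
               (theta (inverse u * of_real (q powr (l * chi (int m) + l * \<beta>))) (q powr (2 * l))
                 + e n m)
               / of_real (cconst q r a s b *
                    q powr (l * real (m div 2) * (real n * t - real (m div 2))))) \<and>
          (\<forall>\<^sub>F n in sequentially. \<forall>(m::nat) \<gamma>::real. n > 0 \<and> m > 0 \<and>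
              real n * t = real m + \<beta> + \<gamma> \<and> \<bar>\<gamma>\<bar> \<le> 3 / real n \<longrightarrow>
             cmod (e n m) \<le>
               48 * (\<Prod>j=1..s. qpoch_inf (- b j * q ^ 2) q) * theta (inverse (cmod u)) (q powr l)
                 / ((1 - q) * (\<Prod>j=1..r. qpoch_inf (a j) q)) *
               (ln (real n) / real n
                 + q powr (l * real_of_int (nu q n) ^ 2 / 2) * cmod u powi nu q n
                 + q powr (l * real_of_int (nu q n) ^ 2 / 2) / cmod u powi (1 + nu q n)))))"
proof (intro conjI allI impI)
  define g where "g = weight q r a s b"
  have geom: "geom_close q g"
    unfolding g_def using assms by (intro geom_close_weight)
  define R where "R = (\<lambda>M y y0. (\<Sum>\<^sub>\<infinity>j. of_real (extend_by_zero g (int M - j)) * theta_term q l u y j)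
      - (\<Sum>\<^sub>\<infinity>j. theta_term q l u y0 j))"
  obtain K where K: "K > 0" "\<And>M y y0. \<bar>y0\<bar> \<le> 5 \<Longrightarrow> \<bar>y\<bar> \<le> 5 \<Longrightarrow>
      cmod (R M y y0) \<le> K * (q powr real_of_int (int M) + \<bar>y - y0\<bar>)"
    using theta_remainder_bound[OF assms(1-3,6) geom, of 5] unfolding R_def by metis
  \<comment> \<open>An identity for all n, m, t and x, since R is defined as the exact difference.
    The relation between n t and m enters only through the size of R.\<close>
  have expansion: "qseries q l r a s b (of_real (q powr (- l * real n * t)) * u) =
      u ^ (m div 2) *
        (theta (inverse u * of_real (q powr (l * chi (int m) + l * x))) (q powr (2 * l))
          + R (m div 2) (real n * t - 2 * real (m div 2)) (real_of_int (chi (int m)) + x))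
      / of_real (cconst q r a s b * q powr (l * real (m div 2) * (real n * t - real (m div 2))))"
    for n m t x
    using qseries_eq_theta_sum[OF assms(1-3,6,4,5), where r=r and s=s and x="real n * t" and M="m div 2"]
      theta_eq_infsum_theta_term[OF assms(1), of u l "real_of_int (chi (int m)) + x"]
    by (simp add: R_def g_def distrib_left mult.assoc)
  define PB where "PB = (\<Prod>j=1..s. qpoch_inf (- b j * q ^ 2) q)"
  define TH where "TH = theta (inverse (cmod u)) (q powr l)"
  define PA where "PA = (\<Prod>j=1..r. qpoch_inf (a j) q)"
  have b_neg: "- b j * q ^ 2 < 1" if "j \<in> {1..s}" for j
    using assms(5)[OF that] by (smt (verit) mult_nonneg_nonneg zero_le_power2 mult_minus_left)
  have pos: "PB > 0" "TH > 0" "PA > 0"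
    unfolding PB_def TH_def PA_def using assms b_neg
    by (auto intro!: prod_pos qpoch_inf_pos theta_pos)
  {
    fix t lam :: real
    assume t: "t > 0 \<and> t \<in> \<rat> \<and> lam \<in> frac_multiples t"
    show "infinite {(n::nat, m::nat). n > 0 \<and> m > 0 \<and> t * real n = real m + lam}"
      using t by (intro infinite_frac_multiples) auto
    have lam: "0 \<le> lam" "lam < 1"
      using t unfolding frac_multiples_def by (auto simp: frac_lt_1)
    \<comment> \<open>The rational remainder must be a function of n alone; m is recovered from n as
      t n - lam.\<close>
    define mm where "mm = (\<lambda>n. nat \<lfloor>t * real n - lam\<rfloor>)"
    have mm: "mm n = m" if "t * real n = real m + lam" for n m
      using that by (simp add: mm_def)
    define D where "D = (2 / (1 - q)) ^ (r + s + 1) * (PB * TH / PA)"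
    have D: "D > 0" unfolding D_def using pos assms by simp
    define rem where "rem = (\<lambda>n. R (mm n div 2) (real n * t - 2 * real (mm n div 2)) (real_of_int (chi (int (mm n))) + lam))"
    show "\<exists>rem :: nat \<Rightarrow> complex.
          (\<forall>n m :: nat. n > 0 \<and> m > 0 \<and> t * real n = real m + lam \<longrightarrow>
             qseries q l r a s b (of_real (q powr (- l * real n * t)) * u) =
               u ^ (m div 2) *
               (theta (inverse u * of_real (q powr (l * chi (int m) + l * lam))) (q powr (2 * l))
                 + rem n)
               / of_real (cconst q r a s b *
                    q powr (l * real (m div 2) * (real n * t - real (m div 2))))) \<and>
          (\<forall>\<^sub>F n in sequentially. \<forall>m :: nat. n > 0 \<and> m > 0 \<and> t * real n = real m + lam \<longrightarrow>
             cmod (rem n) \<le>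
               (2 / (1 - q)) ^ (r + s + 1) *
               ((\<Prod>j=1..s. qpoch_inf (- b j * q ^ 2) q) * theta (inverse (cmod u)) (q powr l)
                 / (\<Prod>j=1..r. qpoch_inf (a j) q)) *
               (q powr (real m / 4)
                 + q powr (l * real m ^ 2 / 16) / cmod u ^ (m div 4 + 1)))"
      unfolding PB_def[symmetric] TH_def[symmetric] PA_def[symmetric] D_def[symmetric]
    proof (intro exI[of _ rem] conjI allI impI)
      fix n m :: nat
      assume nm: "n > 0 \<and> m > 0 \<and> t * real n = real m + lam"
      then have "rem n = R (m div 2) (real n * t - 2 * real (m div 2)) (real_of_int (chi (int m)) + lam)"
        by (simp add: rem_def mm)
      then show "qseries q l r a s b (of_real (q powr (- l * real n * t)) * u) =
               u ^ (m div 2) *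
               (theta (inverse u * of_real (q powr (l * chi (int m) + l * lam))) (q powr (2 * l))
                 + rem n)
               / of_real (cconst q r a s b *
                    q powr (l * real (m div 2) * (real n * t - real (m div 2))))"
        using expansion[of n t m lam] by simp
    next
      have "\<forall>\<^sub>F n in sequentially. \<forall>m::nat. t * real n = real m + lam \<longrightarrow>
          K * q powr real_of_int (int (m div 2)) \<le> D * q powr (real m / 4)"
        using assms t lam K D by (intro rational_remainder_eventually_le) auto
      then show "\<forall>\<^sub>F n in sequentially. \<forall>m :: nat. n > 0 \<and> m > 0 \<and> t * real n = real m + lam \<longrightarrow>
             cmod (rem n) \<le> D * (q powr (real m / 4)
                 + q powr (l * real m ^ 2 / 16) / cmod u ^ (m div 4 + 1))"
      proof (rule eventually_mono, intro allI impI)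
        fix n m :: nat
        assume le: "\<forall>m::nat. t * real n = real m + lam \<longrightarrow>
            K * q powr real_of_int (int (m div 2)) \<le> D * q powr (real m / 4)"
          and nm: "n > 0 \<and> m > 0 \<and> t * real n = real m + lam"
        \<comment> \<open>The exponent is exactly the one in the theta function, so only the q^M
          part of the error remains.\<close>
        have y: "real n * t - 2 * real (m div 2) = real_of_int (chi (int m)) + lam"
          using nm by (simp add: real_chi mult.commute)
        have "cmod (rem n) = cmod (R (m div 2) (real_of_int (chi (int m)) + lam) (real_of_int (chi (int m)) + lam))"
          using nm by (simp add: rem_def mm y)
        also have "\<dots> \<le> K * (q powr real_of_int (int (m div 2))
            + \<bar>real_of_int (chi (int m)) + lam - (real_of_int (chi (int m)) + lam)\<bar>)"
          using lam by (intro K abs_chi_add_le(1)[where \<gamma>=0]) auto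
        also have "\<dots> = K * q powr real_of_int (int (m div 2))" by simp
        also have "\<dots> \<le> D * q powr (real m / 4)" using le nm by blast
        also have "\<dots> \<le> D * (q powr (real m / 4)
            + q powr (l * real m ^ 2 / 16) / cmod u ^ (m div 4 + 1))"
          using D by (intro mult_left_mono) auto
        finally show "cmod (rem n) \<le> D * (q powr (real m / 4)
            + q powr (l * real m ^ 2 / 16) / cmod u ^ (m div 4 + 1))" .
      qed
    qed
  }
  {
    fix t \<beta> :: real
    assume t: "t > 0 \<and> t \<notin> \<rat> \<and> 0 \<le> \<beta> \<and> \<beta> < 1"
    show "infinite {(n::nat, m::nat). n > 0 \<and> m > 0 \<and>
         (\<exists>\<gamma>::real. real n * t = real m + \<beta> + \<gamma> \<and> \<bar>\<gamma>\<bar> \<le> 3 / real n)}"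
      using t by (intro infinite_inhomogeneous_approximations) auto
    define D where "D = 48 * PB * TH / ((1 - q) * PA)"
    have D: "D > 0" unfolding D_def using pos assms by simp
    \<comment> \<open>The remainder depends on m too: for small n the tolerance 3 / n may admit
      several m. Given n and m, \<gamma> is determined.\<close>
    define e where "e = (\<lambda>n m. R (m div 2) (real n * t - 2 * real (m div 2)) (real_of_int (chi (int m)) + \<beta>))"
    show "\<exists>e :: nat \<Rightarrow> nat \<Rightarrow> complex.
          (\<forall>(n::nat) (m::nat) \<gamma>::real. n > 0 \<and> m > 0 \<and>
              real n * t = real m + \<beta> + \<gamma> \<and> \<bar>\<gamma>\<bar> \<le> 3 / real n \<longrightarrow>
             qseries q l r a s b (of_real (q powr (- l * real n * t)) * u) =
               u ^ (m div 2) *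
               (theta (inverse u * of_real (q powr (l * chi (int m) + l * \<beta>))) (q powr (2 * l))
                 + e n m)
               / of_real (cconst q r a s b *
                    q powr (l * real (m div 2) * (real n * t - real (m div 2))))) \<and>
          (\<forall>\<^sub>F n in sequentially. \<forall>(m::nat) \<gamma>::real. n > 0 \<and> m > 0 \<and>
              real n * t = real m + \<beta> + \<gamma> \<and> \<bar>\<gamma>\<bar> \<le> 3 / real n \<longrightarrow>
             cmod (e n m) \<le>
               48 * (\<Prod>j=1..s. qpoch_inf (- b j * q ^ 2) q) * theta (inverse (cmod u)) (q powr l)
                 / ((1 - q) * (\<Prod>j=1..r. qpoch_inf (a j) q)) *
               (ln (real n) / real n
                 + q powr (l * real_of_int (nu q n) ^ 2 / 2) * cmod u powi nu q n
                 + q powr (l * real_of_int (nu q n) ^ 2 / 2) / cmod u powi (1 + nu q n)))"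
      unfolding PB_def[symmetric] TH_def[symmetric] PA_def[symmetric] D_def[symmetric]
    proof (intro exI[of _ e] conjI allI impI)
      fix n m :: nat
      show "qseries q l r a s b (of_real (q powr (- l * real n * t)) * u) =
               u ^ (m div 2) *
               (theta (inverse u * of_real (q powr (l * chi (int m) + l * \<beta>))) (q powr (2 * l))
                 + e n m)
               / of_real (cconst q r a s b *
                    q powr (l * real (m div 2) * (real n * t - real (m div 2))))"
        unfolding e_def by (rule expansion)
    next
      have "\<forall>\<^sub>F n in sequentially. \<forall>(m::nat) \<gamma>. n > 0 \<and> real n * t = real m + \<beta> + \<gamma> \<and> \<bar>\<gamma>\<bar> \<le> 3 / real n \<longrightarrow>
          K * (q powr real_of_int (int (m div 2)) + \<bar>\<gamma>\<bar>) \<le> D * (ln (real n) / real n)"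
        using assms t K D by (intro irrational_remainder_eventually_le) auto
      then show "\<forall>\<^sub>F n in sequentially. \<forall>(m::nat) \<gamma>::real. n > 0 \<and> m > 0 \<and>
              real n * t = real m + \<beta> + \<gamma> \<and> \<bar>\<gamma>\<bar> \<le> 3 / real n \<longrightarrow>
             cmod (e n m) \<le> D * (ln (real n) / real n
                 + q powr (l * real_of_int (nu q n) ^ 2 / 2) * cmod u powi nu q n
                 + q powr (l * real_of_int (nu q n) ^ 2 / 2) / cmod u powi (1 + nu q n))"
      proof (rule eventually_mono, intro allI impI)
        fix n m :: nat and \<gamma> :: real
        assume le: "\<forall>(m::nat) \<gamma>. n > 0 \<and> real n * t = real m + \<beta> + \<gamma> \<and> \<bar>\<gamma>\<bar> \<le> 3 / real n \<longrightarrow>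
            K * (q powr real_of_int (int (m div 2)) + \<bar>\<gamma>\<bar>) \<le> D * (ln (real n) / real n)"
          and nm: "n > 0 \<and> m > 0 \<and> real n * t = real m + \<beta> + \<gamma> \<and> \<bar>\<gamma>\<bar> \<le> 3 / real n"
        \<comment> \<open>The exponent differs from that of the limiting theta function by exactly
          \<gamma>.\<close>
        have y: "real n * t - 2 * real (m div 2) = real_of_int (chi (int m)) + \<beta> + \<gamma>"
          using nm by (simp add: real_chi)
        have "3 / real n \<le> 3" using nm by (simp add: field_simps)
        then have \<gamma>: "\<bar>\<gamma>\<bar> \<le> 3" using nm by linarith
        have "cmod (e n m) = cmod (R (m div 2) (real_of_int (chi (int m)) + \<beta> + \<gamma>) (real_of_int (chi (int m)) + \<beta>))"
          by (simp add: e_def y)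
        also have "\<dots> \<le> K * (q powr real_of_int (int (m div 2))
            + \<bar>real_of_int (chi (int m)) + \<beta> + \<gamma> - (real_of_int (chi (int m)) + \<beta>)\<bar>)"
          using t \<gamma> by (intro K abs_chi_add_le) auto
        also have "\<dots> = K * (q powr real_of_int (int (m div 2)) + \<bar>\<gamma>\<bar>)" by simp
        also have "\<dots> \<le> D * (ln (real n) / real n)" using le nm by blast
        also have "\<dots> \<le> D * (ln (real n) / real n
                 + q powr (l * real_of_int (nu q n) ^ 2 / 2) * cmod u powi nu q n
                 + q powr (l * real_of_int (nu q n) ^ 2 / 2) / cmod u powi (1 + nu q n))"
        proof -
          have "0 \<le> q powr (l * real_of_int (nu q n) ^ 2 / 2) * cmod u powi nu q n"
            "0 \<le> q powr (l * real_of_int (nu q n) ^ 2 / 2) / cmod u powi (1 + nu q n)"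
            by (simp_all add: zero_le_power_int)
          then show ?thesis using D by (intro mult_left_mono) linarith+
        qed
        finally show "cmod (e n m) \<le> D * (ln (real n) / real n
                 + q powr (l * real_of_int (nu q n) ^ 2 / 2) * cmod u powi nu q n
                 + q powr (l * real_of_int (nu q n) ^ 2 / 2) / cmod u powi (1 + nu q n))" .
      qed
    qed
  }
qed

end
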